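(* Let $H\in\operatorname{BH}(n,k)$, let $\mathbf{x}\in\langle\zeta_k\rangle^n$ be $H$-bent, and let $\mathbf{y}=\frac{1}{\sqrt n}H\mathbf{x}$. Suppose $n$ is self-conjugate modulo $k$. Then every entry of $\mathbf{y}$ lies in $\langle\zeta_{2k}\rangle$ if $k$ is even, and in $\langle\zeta_{4k}\rangle$ if $k$ is odd.
   Context: $\zeta_m=e^{2\pi\sqrt{-1}/m}$ and $\langle\zeta_m\rangle$ is the set of $m$-th roots of unity. $\operatorname{BH}(n,k)$ is the set of $n\times n$ matrices $H$ with entries in $\langle\zeta_k\rangle$ with $HH^*=nI_n$. A vector $\mathbf{x}\in\langle\zeta_k\rangle^n$ is $H$-bent if every entry of $\frac1{\sqrt n}H\mathbf{x}$ has modulus $1$. For an integer $m$ and prime $p$, $m_p$ is the highest power of $p$ dividing $m$. The integer $n$ is self-conjugate modulo $k$ if for every prime divisor $p$ of $n$ there is an integer $j\ge 0$ with $p^j\equiv -1\pmod{k/k_p}$. *)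

theory Defs
  imports
    Complex_Main
    "HOL-Number_Theory.Cong"
    "HOL-Computational_Algebra.Primes"
    "Jordan_Normal_Form.Schur_Decomposition"
begin

definition zeta :: "nat \<Rightarrow> complex" where
  "zeta m = exp (2 * of_real pi * \<i> / of_nat m)"

text \<open>The cyclic group generated by \<open>\<zeta>\<^sub>m\<close>. For \<open>m > 0\<close> it is the set of
  \<open>m\<close>-th roots of unity, see \<open>zeta_group_eq\<close> below.\<close>

definition zeta_group :: "nat \<Rightarrow> complex set" where
  "zeta_group m = range (\<lambda>j::int. zeta m powi j)"

definition BH :: "nat \<Rightarrow> nat \<Rightarrow> complex mat set" where
  "BH n k = {H \<in> carrier_mat n n.
     (\<forall>i<n. \<forall>j<n. H $$ (i, j) \<in> zeta_group k) \<and>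
     H * mat_adjoint H = of_nat n \<cdot>\<^sub>m 1\<^sub>m n}"

definition zeta_vecs :: "nat \<Rightarrow> nat \<Rightarrow> complex vec set" where
  "zeta_vecs n k = {x \<in> carrier_vec n. \<forall>i<n. x $ i \<in> zeta_group k}"

definition scaled_image :: "nat \<Rightarrow> complex mat \<Rightarrow> complex vec \<Rightarrow> complex vec" where
  "scaled_image n H x = complex_of_real (1 / sqrt (real n)) \<cdot>\<^sub>v (H *\<^sub>v x)"

definition bent :: "nat \<Rightarrow> nat \<Rightarrow> complex mat \<Rightarrow> complex vec \<Rightarrow> bool" where
  "bent n k H x \<longleftrightarrow>
     x \<in> zeta_vecs n k \<and> (\<forall>i<n. cmod (scaled_image n H x $ i) = 1)"

definition prime_part :: "nat \<Rightarrow> nat \<Rightarrow> nat" where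
  "prime_part p m = p ^ multiplicity p m"

definition self_conjugate_mod :: "nat \<Rightarrow> nat \<Rightarrow> bool" where
  "self_conjugate_mod n k \<longleftrightarrow>
     (\<forall>p. prime p \<and> p dvd n \<longrightarrow>
        (\<exists>j::nat. [int p ^ j = - 1] (mod int (k div prime_part p k))))"

lemma zeta_group_eq:
  assumes "m > 0"
  shows "zeta_group m = {z. z ^ m = 1}"
proof (intro equalityI subsetI)
  have cis: "zeta m = cis (2 * pi / real m)"
    by (simp add: zeta_def cis_conv_exp mult_ac)
  have one: "zeta m ^ m = 1"
    using assms by (simp add: cis DeMoivre)
  fix z :: complex
  {
    assume "z \<in> zeta_group m"
    then obtain j :: int where "z = zeta m powi j"
      by (auto simp: zeta_group_def)
    then have "z ^ m = (zeta m ^ m) powi j"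
      by (metis mult.commute power_int_mult power_int_of_nat)
    then show "z \<in> {z. z ^ m = 1}"
      by (simp add: one)
  next
    assume "z \<in> {z. z ^ m = 1}"
    then obtain j where "z = cis (2 * pi * real j / real m)"
      using bij_betw_roots_unity [OF assms] unfolding bij_betw_def by blast
    then have "z = zeta m powi int j"
      by (simp add: cis DeMoivre mult_ac)
    then show "z \<in> zeta_group m"
      unfolding zeta_group_def by (rule range_eqI)
  }
qed

end

theory Submission
  imports Defs "HOL-Computational_Algebra.Polynomial_Factorial" "HOL-Number_Theory.Residues"
begin

text \<open>Let \<open>X\<close> be an entry of \<open>H x\<close>, an element of the cyclotomic ring \<open>R\<close> generated by
  \<open>\<zeta> = zeta k\<close>, with \<open>X * cnj X = n\<close>. For a prime \<open>p\<close> dividing \<open>n\<close> write \<open>k = m * p ^ e\<close>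
  with \<open>p\<close> not dividing \<open>m\<close>, and let \<open>\<pi>\<close> be \<open>1 - \<zeta> ^ m\<close> (or \<open>p\<close>, if \<open>e = 0\<close>), so that \<open>p\<close> is
  associated to a power of \<open>\<pi>\<close>. Since \<open>m\<close> divides \<open>p ^ j + 1\<close>, the Frobenius map gives
  \<open>x ^ (p ^ j) = cnj x\<close> modulo \<open>\<pi>\<close>. Hence \<open>R\<close> is reduced modulo \<open>\<pi>\<close>, and dividing out \<open>\<pi>\<close>
  repeatedly shows that the powers of \<open>p\<close> dividing \<open>n\<close> divide \<open>X ^ 2\<close>. Therefore
  \<open>X ^ 2 = n * u\<close> with \<open>u\<close> in \<open>R\<close>, all of whose conjugates have modulus 1.

  If \<open>u = g(\<zeta>)\<close> and the prime \<open>p\<close> does not divide \<open>2 * k\<close>, then \<open>g(\<zeta>) ^ p - g(\<zeta> ^ p)\<close> is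
  divisible by \<open>p\<close> while its conjugates have modulus at most \<open>2 < p\<close>, so it vanishes. Thus
  \<open>g(\<zeta>) ^ N = g(\<zeta> ^ N)\<close> for \<open>N\<close> coprime to \<open>2 * k\<close>; taking \<open>N = k + 1\<close> for even and
  \<open>N = 2 * k + 1\<close> for odd \<open>k\<close> shows that \<open>u\<close> is a root of unity of order dividing \<open>N - 1\<close>,
  and \<open>u\<close> is the square of the corresponding entry of \<open>y\<close>.\<close>

hide_const (open) up_ring.monom up_ring.coeff

subsection \<open>Integer polynomials at complex numbers\<close>

text \<open>Elements of the ring generated by \<open>z\<close> are written as \<open>ev f z\<close>,
  so that evaluating the same \<open>f\<close> at another root stands in for a Galois
  automorphism.\<close>

definition ev :: "int poly \<Rightarrow> complex \<Rightarrow> complex" where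
  "ev f z = poly (map_poly of_int f) z"

lemma ev_simps [simp]:
  "ev 0 z = 0" "ev 1 z = 1" "ev (f + g) z = ev f z + ev g z" "ev (f - g) z = ev f z - ev g z"
  "ev (- f) z = - ev f z" "ev (f * g) z = ev f z * ev g z" "ev (f ^ n) z = ev f z ^ n"
  "ev (monom c i) z = of_int c * z ^ i" "ev (of_nat m) z = of_nat m" "ev [:c:] z = of_int c"
  "ev (smult c f) z = of_int c * ev f z" "ev (pCons c f) z = of_int c + z * ev f z"
  by (simp_all add: ev_def hom_distribs poly_monom map_poly_monom map_poly_pCons)

lemma ev_pcompose [simp]: "ev (pcompose f g) z = ev f (ev g z)"
  by (induction f) (simp_all add: pcompose_pCons)

lemma ev_altdef: "ev f z = (\<Sum>i\<le>degree f. of_int (coeff f i) * z ^ i)"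
  by (simp add: ev_def poly_altdef coeff_map_poly)

lemma cnj_ev: "cnj (ev f z) = ev f (cnj z)"
  by (simp add: ev_altdef)

lemma ev_dvd_zero: "f dvd g \<Longrightarrow> ev f z = 0 \<Longrightarrow> ev g z = 0"
  by (auto elim!: dvdE)

section \<open>Frobenius congruence for integer polynomials\<close>

lemma prime_dvd_power_add:
  fixes a b :: "'a::comm_ring_1"
  assumes p: "prime p"
  shows "of_nat p dvd (a + b) ^ p - (a ^ p + b ^ p)"
proof -
  have p0: "p > 0" "p \<noteq> 0" using p prime_gt_0_nat by auto
  have "(a + b) ^ p = (\<Sum>i\<le>p. of_nat (p choose i) * a ^ i * b ^ (p - i))"
    by (rule binomial_ring)
  also have "\<dots> = (\<Sum>i\<in>{0, p}. of_nat (p choose i) * a ^ i * b ^ (p - i))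
      + (\<Sum>i\<in>{..p} - {0, p}. of_nat (p choose i) * a ^ i * b ^ (p - i))"
    by (subst sum.subset_diff[of "{0, p}"]) auto
  also have "(\<Sum>i\<in>{0, p}. of_nat (p choose i) * a ^ i * b ^ (p - i)) = a ^ p + b ^ p"
    using p0 by simp
  finally have "(a + b) ^ p - (a ^ p + b ^ p) =
      (\<Sum>i\<in>{..p} - {0, p}. of_nat (p choose i) * a ^ i * b ^ (p - i))" by simp
  moreover have "of_nat p dvd (\<Sum>i\<in>{..p} - {0, p}. of_nat (p choose i) * a ^ i * b ^ (p - i))"
  proof (rule dvd_sum)
    fix i assume "i \<in> {..p} - {0, p}"
    then have "p dvd (p choose i)"
      using p0 p by (intro dvd_choose_prime) auto
    then have "of_nat p dvd (of_nat (p choose i) :: 'a)" by (metis dvd_def of_nat_mult)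
    then show "of_nat p dvd of_nat (p choose i) * a ^ i * b ^ (p - i)"
      by (metis dvd_mult2 mult.assoc)
  qed
  ultimately show ?thesis by simp
qed

lemma prime_dvd_power_self_diff:
  fixes c :: int
  assumes "prime p"
  shows "int p dvd c ^ p - c"
proof -
  have *: "int p dvd int m ^ p - int m" for m :: nat
  proof (cases "p dvd m")
    case True
    then show ?thesis using assms
      by (metis dvd_diff dvd_power dvd_trans int_dvd_int_iff prime_gt_0_nat)
  next
    case False
    then have "[m ^ (p - 1) * m = 1 * m] (mod p)"
      using assms by (intro cong_mult fermat_theorem) auto
    then have "[m ^ p = m] (mod p)"
      using assms by (metis mult_1 power_minus_mult prime_gt_0_nat)
    then have "[int (m ^ p) = int m] (mod int p)" by (simp only: cong_int_iff)
    then show ?thesis by (simp add: cong_iff_dvd_diff)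
  qed
  define m where "m = nat (c mod int p)"
  have m: "[c = int m] (mod int p)"
    using assms by (auto simp: m_def cong_def prime_gt_0_nat)
  then have "[c ^ p - c = int m ^ p - int m] (mod int p)"
    by (intro cong_diff cong_pow)
  with *[of m] show ?thesis by (simp add: cong_dvd_iff)
qed

text \<open>Induction on the coefficients: modulo \<open>p\<close> the power of
  \<open>c + x * F\<close> splits into a sum of powers, Fermat's little theorem fixes
  \<open>c\<close>, and the induction hypothesis handles \<open>F\<close>.\<close>

lemma frobenius_poly:
  fixes F :: "int poly"
  assumes p: "prime p"
  shows "of_nat p dvd F ^ p - pcompose F (monom 1 p)"
proof (induction F)
  case 0
  then show ?case using prime_gt_0_nat[OF p] by (simp add: zero_power)
next
  case (pCons c F)
  let ?x = "monom 1 1 :: int poly"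
  have eq: "pCons c F = [:c:] + ?x * F"
    by (simp add: monom_altdef)
  have 1: "of_nat p dvd (pCons c F) ^ p - ([:c:] ^ p + (?x * F) ^ p)"
    unfolding eq by (rule prime_dvd_power_add[OF p])
  have "[:int p:] dvd [:c ^ p - c:]"
    using prime_dvd_power_self_diff[OF p, of c] by simp
  then have 2: "of_nat p dvd [:c:] ^ p - [:c:]"
    by (simp add: of_nat_poly poly_const_pow)
  have 3: "of_nat p dvd ?x ^ p * (F ^ p - pcompose F (monom 1 p))"
    using pCons.IH by (rule dvd_mult)
  have "pCons c F ^ p - pcompose (pCons c F) (monom 1 p)
    = (pCons c F ^ p - ([:c:] ^ p + (?x * F) ^ p)) + ([:c:] ^ p - [:c:])
      + ?x ^ p * (F ^ p - pcompose F (monom 1 p))"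
    by (simp add: pcompose_pCons power_mult_distrib monom_power algebra_simps)
  then show ?case using 1 2 3 by (metis dvd_add)
qed

lemma pcompose_monom_1: "pcompose (monom 1 i) g = (g :: int poly) ^ i"
  by (induction i) (simp_all add: monom_Suc pcompose_pCons)

lemma frobenius_poly_iterated:
  fixes F :: "int poly"
  assumes p: "prime p"
  shows "of_nat p dvd F ^ (p ^ j) - pcompose F (monom 1 (p ^ j))"
proof (induction j)
  case 0
  show ?case by (simp add: monom_altdef)
next
  case (Suc j)
  let ?G = "pcompose F (monom 1 (p ^ j))"
  have "F ^ (p ^ j) - ?G dvd (F ^ (p ^ j)) ^ p - ?G ^ p"
    by (simp add: power_diff_sumr2)
  then have 1: "of_nat p dvd (F ^ (p ^ j)) ^ p - ?G ^ p" using Suc dvd_trans by blast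
  have 2: "of_nat p dvd ?G ^ p - pcompose ?G (monom 1 p)" by (rule frobenius_poly[OF p])
  have "pcompose ?G (monom 1 p) = pcompose F (monom 1 (p ^ Suc j))"
    by (simp add: pcompose_assoc[symmetric] pcompose_monom_1 monom_power mult.commute)
  with dvd_add[OF 1 2] show ?case by (simp add: mult.commute flip: power_mult)
qed

subsection \<open>Power sums over the roots of unity\<close>

lemma sum_powers_root_of_unity:
  fixes u :: complex
  assumes "u ^ k = 1"
  shows "(\<Sum>j<k. u ^ j) = (if u = 1 then of_nat k else 0)"
  using assms by (simp add: geometric_sum)

lemma finite_unity: "k > 0 \<Longrightarrow> finite {w::complex. w ^ k = 1}"
  by (rule finite_roots_unity) simp

lemma sum_unity_power_Ints:
  assumes "k > 0"
  shows "(\<Sum>w | w ^ k = 1. w ^ i) \<in> (\<int> :: complex set)"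
proof -
  define u where "u = cis (2 * pi * real i / real k)"
  have "(\<Sum>w | w ^ k = 1. w ^ i) = (\<Sum>t<k. cis (2 * pi * real t / real k) ^ i)"
    using assms by (intro sum.reindex_bij_betw [symmetric] bij_betw_roots_unity) auto
  also have "\<dots> = (\<Sum>t<k. u ^ t)"
    by (intro sum.cong refl) (auto simp: u_def DeMoivre mult_ac)
  also have "u ^ k = 1"
    using assms cis_multiple_2pi[of "real i"] by (simp add: u_def DeMoivre mult.assoc)
  then have "(\<Sum>t<k. u ^ t) \<in> \<int>" by (simp add: sum_powers_root_of_unity)
  finally show ?thesis .
qed

lemma sum_unity_ev_Ints:
  assumes "k > 0"
  shows "(\<Sum>w | w ^ k = 1. ev g w) \<in> \<int>"
proof -
  have "(\<Sum>w | w ^ k = 1. ev g w)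
      = (\<Sum>i\<le>degree g. of_int (coeff g i) * (\<Sum>w | w ^ k = 1. w ^ i))"
    unfolding ev_altdef by (subst sum.swap) (simp add: sum_distrib_left)
  also have "\<dots> \<in> \<int>" by (intro Ints_sum Ints_mult sum_unity_power_Ints assms) auto
  finally show ?thesis .
qed

text \<open>Fourier inversion on the group of \<open>k\<close>-th roots of unity: weighting the
  \<open>j\<close>-th sum by \<open>(1 / w) ^ j\<close> and adding over \<open>j < k\<close>
  isolates \<open>k * ev g w\<close>.\<close>

lemma ev_zero_if_sums_zero:
  assumes k: "k > 0" and w: "w ^ k = 1"
    and sums: "\<And>j. (\<Sum>v | v ^ k = 1. ev g v * v ^ j) = 0"
  shows "ev g w = 0"
proof -
  have w0: "w \<noteq> 0" using w k by (auto simp: zero_power)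
  have "0 = (\<Sum>j<k. (1 / w) ^ j * (\<Sum>v | v ^ k = 1. ev g v * v ^ j))"
    by (simp add: sums)
  also have "\<dots> = (\<Sum>v | v ^ k = 1. ev g v * (\<Sum>j<k. (v / w) ^ j))"
    unfolding sum_distrib_left by (subst sum.swap) (simp add: power_divide field_simps)
  also have "\<dots> = (\<Sum>v | v ^ k = 1. if v = w then ev g w * of_nat k else 0)"
  proof (intro sum.cong refl)
    fix v :: complex assume "v \<in> {v. v ^ k = 1}"
    then have "(v / w) ^ k = 1" using w by (simp add: power_divide)
    then show "ev g v * (\<Sum>j<k. (v / w) ^ j) = (if v = w then ev g w * of_nat k else 0)"
      using w0 by (simp add: sum_powers_root_of_unity)
  qed
  also have "\<dots> = ev g w * of_nat k" using w finite_unity[OF k] by simp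
  finally show ?thesis using k by simp
qed

subsection \<open>Conjugates of a root of unity\<close>

text \<open>The pseudo-remainder of \<open>f\<close> by \<open>h\<close> vanishes at
  \<open>z\<close>; a nonzero one would have smaller degree than \<open>h\<close>.\<close>

lemma pseudo_division_min_degree:
  fixes f h :: "int poly"
  assumes h: "h \<noteq> 0" "ev h z = 0" and min: "\<And>g. g \<noteq> 0 \<Longrightarrow> ev g z = 0 \<Longrightarrow> degree h \<le> degree g"
    and f: "ev f z = 0"
  obtains c g where "c \<noteq> 0" "smult c f = h * g"
proof -
  obtain c g where c: "c \<noteq> 0" "smult c f = h * g + pseudo_mod f h"
    using pseudo_mod(1)[OF h(1), of f] by auto
  have "ev (pseudo_mod f h) z = ev (smult c f) z - ev (h * g) z" by (simp add: c)
  also have "\<dots> = 0" using f h by simp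
  finally have "pseudo_mod f h = 0"
    using pseudo_mod(2)[OF h(1), of f] min[of "pseudo_mod f h"] by fastforce
  with c show ?thesis using that by simp
qed

lemma prime_elem_divisor_vanishing:
  assumes "f \<noteq> 0" "ev f z = 0"
  obtains \<phi> :: "int poly" where "prime_elem \<phi>" "\<phi> dvd f" "ev \<phi> z = 0"
proof -
  have "f \<noteq> 0 \<longrightarrow> ev f z = 0 \<longrightarrow> (\<exists>\<phi>. prime_elem \<phi> \<and> \<phi> dvd f \<and> ev \<phi> z = 0)"
  proof (induction f rule: prime_divisors_induct)
    case (unit f)
    then obtain g where "f * g = 1" by (metis dvdE)
    then have "ev f z * ev g z = 1" by (metis ev_simps(2,6))
    then show ?case by auto
  next
    case (factor p f)
    then show ?case by (auto intro: prime_imp_prime_elem)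
  qed auto
  with assms that show ?thesis by blast
qed

text \<open>\<open>\<phi>\<close> acts as a minimal polynomial. For \<open>h\<close> of least degree
  vanishing at \<open>z\<close>, \<open>\<phi>\<close> divides some \<open>h * g\<close> but not
  \<open>g\<close>, since otherwise \<open>h\<close> would divide a nonzero constant. So
  \<open>\<phi>\<close> divides \<open>h\<close>, which divides a nonzero integer multiple of
  \<open>f\<close>.\<close>

lemma prime_elem_vanishing_transfer:
  assumes \<phi>: "prime_elem \<phi>" "ev \<phi> z = 0" and f: "ev f z = 0" and w: "ev \<phi> w = 0"
  shows "ev f w = 0"
proof -
  have \<phi>0: "\<phi> \<noteq> 0" using \<phi> by auto
  obtain h where h: "h \<noteq> 0" "ev h z = 0"
    and min: "\<And>g. g \<noteq> 0 \<Longrightarrow> ev g z = 0 \<Longrightarrow> degree h \<le> degree g"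
    using ex_has_least_nat[of "\<lambda>g. g \<noteq> 0 \<and> ev g z = 0" \<phi> degree] \<phi>0 \<phi> by blast
  obtain c g where c: "c \<noteq> 0" "smult c \<phi> = h * g"
    by (rule pseudo_division_min_degree[OF h min \<phi>(2)])
  have "\<phi> dvd h * g" by (metis c(2) dvd_smult dvd_refl)
  moreover have "\<not> \<phi> dvd g"
  proof
    assume "\<phi> dvd g"
    then obtain g' where "g = \<phi> * g'" by auto
    then have "\<phi> * [:c:] = \<phi> * (h * g')" using c by (simp add: algebra_simps)
    then have "[:c:] = h * g'" using \<phi>0 by (metis mult_cancel_left)
    then have "of_int c = ev h z * ev g' z" by (metis ev_simps(6,10))
    then show False using c h by simp
  qed
  ultimately have "\<phi> dvd h" using \<phi> by (simp add: prime_elem_dvd_mult_iff)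
  then have hw: "ev h w = 0" using w by (rule ev_dvd_zero)
  obtain d g' where "d \<noteq> 0" "smult d f = h * g'"
    by (rule pseudo_division_min_degree[OF h min f])
  then have "of_int d * ev f w = ev h w * ev g' w" by (metis ev_simps(6,11))
  with hw \<open>d \<noteq> 0\<close> show ?thesis by simp
qed

text \<open>The roots of \<open>\<phi>\<close> are the conjugates of \<open>\<zeta>\<close>, and
  \<open>transfer\<close> replaces the Galois action. The cofactor \<open>\<psi>\<close> vanishes at
  every other \<open>k\<close>-th root of unity, so weighting by it restricts sums to the
  conjugates.\<close>

locale unity_conjugates =
  fixes k :: nat and \<zeta> :: complex and \<phi> \<psi> :: "int poly"
  assumes k: "k > 0"
    and factors: "\<phi> * \<psi> = monom 1 k - 1"
    and phi_zeta: "ev \<phi> \<zeta> = 0"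
    and transfer: "\<And>f w. ev f \<zeta> = 0 \<Longrightarrow> ev \<phi> w = 0 \<Longrightarrow> ev f w = 0"

lemma unity_conjugates_exist:
  assumes "k > 0" "\<zeta> ^ k = 1"
  obtains \<phi> \<psi> where "unity_conjugates k \<zeta> \<phi> \<psi>"
proof -
  let ?f = "monom 1 k - 1 :: int poly"
  have "poly ?f 0 \<noteq> 0" using assms by (simp add: poly_monom zero_power)
  then have "?f \<noteq> 0" by auto
  moreover have "ev ?f \<zeta> = 0" using assms by simp
  ultimately obtain \<phi> where \<phi>: "prime_elem \<phi>" "\<phi> dvd ?f" "ev \<phi> \<zeta> = 0"
    by (rule prime_elem_divisor_vanishing)
  obtain \<psi> where \<psi>: "?f = \<phi> * \<psi>" using \<phi>(2) by (rule dvdE)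
  have "unity_conjugates k \<zeta> \<phi> \<psi>"
    by (rule unity_conjugates.intro[OF assms(1) \<psi>[symmetric] \<phi>(3)
          prime_elem_vanishing_transfer[OF \<phi>(1,3)]])
  then show ?thesis by (rule that)
qed

context unity_conjugates
begin

lemma phi_psi_eq: "ev \<phi> w * ev \<psi> w = w ^ k - 1"
  by (metis factors ev_simps(2,4,6,8) of_int_1 mult_1)

lemma conj_root_unity: "ev \<phi> w = 0 \<Longrightarrow> w ^ k = 1"
  using phi_psi_eq[of w] by simp

lemma psi_eq_0: "w ^ k = 1 \<Longrightarrow> ev \<phi> w \<noteq> 0 \<Longrightarrow> ev \<psi> w = 0"
  using phi_psi_eq[of w] by simp

lemma zeta_unity: "\<zeta> ^ k = 1"
  using conj_root_unity phi_zeta by blast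

text \<open>Differentiating \<open>\<phi> * \<psi> = x ^ k - 1\<close> at a root of
  \<open>\<psi>\<close> leaves only the term with \<open>pderiv \<psi>\<close>; the factor
  \<open>w\<close> turns \<open>k * w ^ (k - 1)\<close> into \<open>k\<close>.\<close>

lemma ev_phi_pderiv_psi:
  assumes "ev \<psi> w = 0" "w ^ k = 1"
  shows "of_nat k = ev \<phi> w * (w * ev (pderiv \<psi>) w)"
proof -
  have "pderiv (\<phi> * \<psi>) = monom (of_nat k) (k - 1)"
    by (simp add: factors pderiv_diff pderiv_monom)
  then have "ev (\<phi> * pderiv \<psi> + \<psi> * pderiv \<phi>) w = of_nat k * w ^ (k - 1)"
    by (simp add: pderiv_mult)
  then have "w * (ev \<phi> w * ev (pderiv \<psi>) w) = w * (of_nat k * w ^ (k - 1))"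
    using assms by simp
  also have "\<dots> = of_nat k * w ^ k" using k by (metis mult.left_commute power_minus_mult mult.commute)
  finally show ?thesis using assms by (simp add: algebra_simps)
qed

lemma psi_zeta: "ev \<psi> \<zeta> \<noteq> 0"
  using ev_phi_pderiv_psi[of \<zeta>] zeta_unity phi_zeta k by auto

lemma sum_psi_Ints: "(\<Sum>w | w ^ k = 1. ev f w * ev \<psi> w * w ^ j) \<in> \<int>"
  using sum_unity_ev_Ints[OF k, of "f * \<psi> * monom 1 j"] by simp

text \<open>The sums of \<open>f ^ m * \<psi>\<close> times powers over all \<open>k\<close>-th roots of unity are integers, and
  \<open>\<psi>\<close> restricts them to the conjugates of \<open>\<zeta>\<close>, so they tend to 0 and eventually vanish.\<close>

lemma bounded_conjugates_imp_zero:
  assumes small: "\<And>w. ev \<phi> w = 0 \<Longrightarrow> cmod (ev f w) < 1"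
  shows "ev f \<zeta> = 0"
proof -
  let ?U = "{w::complex. w ^ k = 1}"
  have fin: "finite ?U" by (rule finite_unity[OF k])
  define N where "N = (\<lambda>m. \<Sum>w\<in>?U. cmod (ev f w ^ m * ev \<psi> w))"
  have "N \<longlonglongrightarrow> (\<Sum>w\<in>?U. 0)"
    unfolding N_def
  proof (intro tendsto_sum)
    fix w assume w: "w \<in> ?U"
    show "(\<lambda>m. cmod (ev f w ^ m * ev \<psi> w)) \<longlonglongrightarrow> 0"
    proof (cases "ev \<phi> w = 0")
      case True
      then show ?thesis
        using small by (intro tendsto_norm_zero tendsto_mult_left_zero LIMSEQ_power_zero) auto
    next
      case False
      then show ?thesis using psi_eq_0 w by simp
    qed
  qed
  then have "eventually (\<lambda>m. N m < 1) sequentially"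
    by (intro order_tendstoD(2)) auto
  then obtain m where m: "N m < 1" by (auto simp: eventually_sequentially)
  have "(\<Sum>v\<in>?U. ev (f ^ m * \<psi>) v * v ^ j) = 0" for j
  proof -
    have "cmod (\<Sum>v\<in>?U. ev (f ^ m) v * ev \<psi> v * v ^ j) \<le> (\<Sum>v\<in>?U. cmod (ev (f ^ m) v * ev \<psi> v * v ^ j))"
      by (rule norm_sum)
    also have "\<dots> = N m"
      unfolding N_def
    proof (intro sum.cong refl)
      fix v assume "v \<in> ?U"
      then have "cmod v = 1" using k power_eq_1_iff[of v k] by auto
      then show "cmod (ev (f ^ m) v * ev \<psi> v * v ^ j) = cmod (ev f v ^ m * ev \<psi> v)"
        by (simp add: norm_mult norm_power)
    qed
    finally show ?thesis
      using sum_psi_Ints[of "f ^ m" j] m by (auto elim!: Ints_cases)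
  qed
  then have "ev (f ^ m * \<psi>) \<zeta> = 0"
    by (rule ev_zero_if_sums_zero[OF k zeta_unity])
  then show ?thesis using psi_zeta by simp
qed

text \<open>If \<open>p\<close> did not divide \<open>c\<close>, comparing sums weighted by powers
  of \<open>f\<close> would make each integer power sum of \<open>\<psi>\<close> divisible by every
  power of \<open>p\<close>, hence zero; inversion would then give
  \<open>ev \<psi> \<zeta> = 0\<close>.\<close>

lemma rational_value_is_integer:
  assumes p: "prime p" and eq: "of_nat p * ev f \<zeta> = of_int c"
  shows "int p dvd c"
proof (rule ccontr)
  assume np: "\<not> int p dvd c"
  have val: "of_nat p * ev f w = of_int c" if "ev \<phi> w = 0" for w
    using transfer[of "of_nat p * f - [:c:]" w] eq that by simp
  have "(\<Sum>v | v ^ k = 1. ev \<psi> v * v ^ j) = 0" for j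
  proof -
    obtain s where s: "(\<Sum>v | v ^ k = 1. ev \<psi> v * v ^ j) = of_int s"
      using sum_psi_Ints[of 1 j] by (auto elim: Ints_cases)
    have "int p ^ N dvd s" for N
    proof -
      obtain t where t: "(\<Sum>v | v ^ k = 1. ev (f ^ N) v * ev \<psi> v * v ^ j) = of_int t"
        using sum_psi_Ints[of "f ^ N" j] by (auto elim: Ints_cases)
      have "complex_of_int (int p ^ N * t)
          = (\<Sum>v | v ^ k = 1. (of_nat p * ev f v) ^ N * (ev \<psi> v * v ^ j))"
        by (simp add: t[symmetric] sum_distrib_left power_mult_distrib algebra_simps)
      also have "\<dots> = (\<Sum>v | v ^ k = 1. of_int c ^ N * (ev \<psi> v * v ^ j))"
      proof (intro sum.cong refl)
        fix v assume "v \<in> {v::complex. v ^ k = 1}"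
        then show "(of_nat p * ev f v) ^ N * (ev \<psi> v * v ^ j) = of_int c ^ N * (ev \<psi> v * v ^ j)"
          using val[of v] psi_eq_0[of v] by (cases "ev \<phi> v = 0") auto
      qed
      also have "\<dots> = complex_of_int (c ^ N * s)" by (simp add: s[symmetric] sum_distrib_left)
      finally have "int p ^ N * t = c ^ N * s" by (simp only: of_int_eq_iff)
      then have "int p ^ N dvd c ^ N * s" by (metis dvd_triv_left)
      moreover have "coprime (int p ^ N) (c ^ N)"
        using np p by (simp add: prime_imp_coprime)
      ultimately show ?thesis by (simp add: coprime_dvd_mult_right_iff)
    qed
    have "s = 0"
    proof (rule ccontr)
      assume "s \<noteq> 0"
      moreover have "\<not> is_unit (int p)" using p by (metis not_prime_unit prime_nat_int_transfer)
      ultimately show False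
        using \<open>\<And>N. int p ^ N dvd s\<close> finite_divisor_powers[of s "int p"]
        by (simp add: infinite_UNIV_nat)
    qed
    then show ?thesis by (simp add: s)
  qed
  then have "ev \<psi> \<zeta> = 0" by (rule ev_zero_if_sums_zero[OF k zeta_unity])
  then show False using psi_zeta by simp
qed

text \<open>If \<open>\<zeta> ^ p\<close> were a root of \<open>\<psi>\<close>, differentiating \<open>\<phi> * \<psi>\<close> there would give \<open>k\<close> as a multiple
  of \<open>\<phi>(\<zeta> ^ p)\<close>, which is divisible by \<open>p\<close> as it is congruent to \<open>\<phi>(\<zeta>) ^ p = 0\<close>.\<close>

lemma conj_power_prime:
  assumes p: "prime p" "\<not> p dvd k" and w: "ev \<phi> w = 0"
  shows "ev \<phi> (w ^ p) = 0"
proof -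
  have "ev \<phi> (\<zeta> ^ p) = 0"
  proof (rule ccontr)
    assume nz: "ev \<phi> (\<zeta> ^ p) \<noteq> 0"
    have u: "(\<zeta> ^ p) ^ k = 1" by (metis power_commutes power_mult mult.commute power_one zeta_unity)
    obtain h where "\<phi> ^ p - pcompose \<phi> (monom 1 p) = of_nat p * h"
      using frobenius_poly[OF p(1), of \<phi>] by auto
    then have "ev (\<phi> ^ p - pcompose \<phi> (monom 1 p)) \<zeta> = ev (of_nat p * h) \<zeta>" by simp
    then have "- ev \<phi> (\<zeta> ^ p) = of_nat p * ev h \<zeta>"
      using phi_zeta prime_gt_0_nat[OF p(1)] by (simp add: zero_power)
    then have h: "ev \<phi> (\<zeta> ^ p) = - (of_nat p * ev h \<zeta>)" by (metis minus_minus)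
    have "of_nat k = ev \<phi> (\<zeta> ^ p) * (\<zeta> ^ p * ev (pderiv \<psi>) (\<zeta> ^ p))"
      using nz psi_eq_0 u by (intro ev_phi_pderiv_psi) auto
    also have "\<dots> = of_nat p * ev (- h * monom 1 p * pcompose (pderiv \<psi>) (monom 1 p)) \<zeta>"
      unfolding h by simp
    finally have "int p dvd int k"
      by (intro rational_value_is_integer
          [OF p(1), of "- h * monom 1 p * pcompose (pderiv \<psi>) (monom 1 p)"]) simp
    with p(2) show False by simp
  qed
  then show ?thesis using transfer[of "pcompose \<phi> (monom 1 p)" w] w by simp
qed

section \<open>Elements whose conjugates all have modulus 1\<close>

lemma conj_unimodular_power_prime:
  assumes uni: "\<And>w. ev \<phi> w = 0 \<Longrightarrow> cmod (ev g w) = 1"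
    and p: "prime p" "\<not> p dvd 2 * k"
  shows "ev g \<zeta> ^ p = ev g (\<zeta> ^ p)"
proof -
  have pk: "\<not> p dvd k" using p by auto
  have "p \<noteq> 2" using p by auto
  then have p3: "p > 2" using prime_ge_2_nat[OF p(1)] by simp
  obtain h where h: "g ^ p - pcompose g (monom 1 p) = of_nat p * h"
    using frobenius_poly[OF p(1), of g] by auto
  have eq: "ev g w ^ p - ev g (w ^ p) = of_nat p * ev h w" for w
    using arg_cong[OF h, of "\<lambda>f. ev f w"] by simp
  \<comment> \<open>The quotient \<open>h\<close> has modulus at most \<open>2 / p\<close> at every
    conjugate, which is below 1 because \<open>p\<close> is odd.\<close>
  have "ev h \<zeta> = 0"
  proof (rule bounded_conjugates_imp_zero)
    fix w assume w: "ev \<phi> w = 0"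
    have "real p * cmod (ev h w) = cmod (ev g w ^ p - ev g (w ^ p))"
      by (simp add: eq norm_mult)
    also have "\<dots> \<le> cmod (ev g w ^ p) + cmod (ev g (w ^ p))" by (rule norm_triangle_ineq4)
    also have "\<dots> = 2" using uni w conj_power_prime[OF p(1) pk w] by (simp add: norm_power)
    finally have "real p * cmod (ev h w) < real p * 1" using p3 by linarith
    then show "cmod (ev h w) < 1" using p3 by (subst (asm) mult_less_cancel_left_pos) auto
  qed
  with eq[of \<zeta>] show ?thesis by simp
qed

text \<open>Induction on the prime factors of \<open>N\<close>, with \<open>g\<close> replaced by
  \<open>g(x ^ N)\<close>. Stability of the conjugates under powers is carried along because it
  makes the new polynomial unimodular at all conjugates.\<close>

lemma conj_unimodular_power:
  assumes N: "N > 0" "coprime N (2 * k)"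
    and uni: "\<And>w. ev \<phi> w = 0 \<Longrightarrow> cmod (ev g w) = 1"
  shows "ev g \<zeta> ^ N = ev g (\<zeta> ^ N) \<and> (\<forall>w. ev \<phi> w = 0 \<longrightarrow> ev \<phi> (w ^ N) = 0)"
  using N
proof (induction N rule: prime_divisors_induct)
  case (unit N)
  then show ?case by simp
next
  case (factor p N)
  have N: "N > 0" "coprime N (2 * k)" using factor.prems by auto
  note IH = factor.IH[OF N]
  have "coprime p (2 * k)" using factor.prems by simp
  then have p: "\<not> p dvd 2 * k" using factor.hyps
    by (metis coprime_absorb_left not_prime_unit)
  then have pk: "\<not> p dvd k" by auto
  define g' where "g' = pcompose g (monom 1 N)"
  have "ev g' \<zeta> ^ p = ev g' (\<zeta> ^ p)"
    using IH uni factor.hyps p by (intro conj_unimodular_power_prime) (auto simp: g'_def)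
  moreover have "ev \<phi> (w ^ (p * N)) = 0" if "ev \<phi> w = 0" for w
    using IH conj_power_prime[OF factor.hyps pk that] by (simp add: power_mult)
  moreover have "ev g \<zeta> ^ (p * N) = ev g' \<zeta> ^ p"
    using IH by (simp add: g'_def power_mult mult.commute[of p])
  ultimately show ?case by (simp add: g'_def power_mult)
qed auto

end

subsection \<open>Divisibility in a cyclotomic ring\<close>

text \<open>The ring obtained by adjoining \<open>z\<close> to the integers.\<close>

definition adj :: "complex \<Rightarrow> complex set" where
  "adj z = range (\<lambda>f. ev f z)"

definition adj_dvd :: "complex \<Rightarrow> complex \<Rightarrow> complex \<Rightarrow> bool" where
  "adj_dvd z a b \<longleftrightarrow> (\<exists>c\<in>adj z. b = a * c)"

lemma adj_ev [intro]: "ev f z \<in> adj z"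
  by (simp add: adj_def)

lemma adj_closed:
  assumes "a \<in> adj z" "b \<in> adj z"
  shows adj_add: "a + b \<in> adj z" and adj_diff: "a - b \<in> adj z"
    and adj_mult: "a * b \<in> adj z"
  using assms by (auto simp: adj_def image_iff simp flip: ev_simps)

lemma adj_uminus: "a \<in> adj z \<Longrightarrow> - a \<in> adj z"
  and adj_power: "a \<in> adj z \<Longrightarrow> a ^ n \<in> adj z"
  by (auto simp: adj_def image_iff simp flip: ev_simps)

lemma adj_of_int [simp]: "of_int c \<in> adj z"
  using adj_ev[of "[:c:]" z] by simp

lemma adj_consts [simp]: "0 \<in> adj z" "1 \<in> adj z" "of_nat n \<in> adj z"
  using adj_of_int[of 0 z] adj_of_int[of 1 z] adj_of_int[of "int n" z] by simp_all

lemma adj_self [simp]: "z \<in> adj z"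
  using adj_ev[of "monom 1 1" z] by simp

lemma adj_sum: "(\<And>i. i \<in> A \<Longrightarrow> f i \<in> adj z) \<Longrightarrow> sum f A \<in> adj z"
  by (induction A rule: infinite_finite_induct) (auto intro: adj_add)

lemma cnj_unity:
  assumes "z ^ k = 1" "k > 0"
  shows "cnj z * z = 1" "cnj z = z ^ (k - 1)"
proof -
  have "cmod z = 1" using assms power_eq_1_iff[of z k] by auto
  then show 1: "cnj z * z = 1" by (metis complex_norm_square mult.commute of_real_1 one_power2)
  have "z ^ (k - 1) * z = 1" using assms by (metis power_minus_mult)
  with 1 show "cnj z = z ^ (k - 1)" by (metis mult_cancel_right mult_zero_right zero_neq_one)
qed

lemma adj_cnj:
  assumes "z ^ k = 1" "k > 0" "a \<in> adj z"
  shows "cnj a \<in> adj z"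
proof -
  obtain f where "a = ev f z" using assms(3) by (auto simp: adj_def)
  then have "cnj a = ev (pcompose f (monom 1 (k - 1))) z"
    using cnj_unity[OF assms(1,2)] by (simp add: cnj_ev)
  then show ?thesis by (metis adj_ev)
qed

lemma adj_dvd_refl [simp]: "adj_dvd z a a"
  by (auto simp: adj_dvd_def intro!: bexI[of _ 1])

lemma adj_dvd_zero [simp]: "adj_dvd z a 0"
  by (auto simp: adj_dvd_def intro!: bexI[of _ 0])

lemma adj_dvd_add: "adj_dvd z a b \<Longrightarrow> adj_dvd z a c \<Longrightarrow> adj_dvd z a (b + c)"
  by (auto simp: adj_dvd_def) (metis adj_add distrib_left)

lemma adj_dvd_diff: "adj_dvd z a b \<Longrightarrow> adj_dvd z a c \<Longrightarrow> adj_dvd z a (b - c)"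
  by (auto simp: adj_dvd_def) (metis adj_diff right_diff_distrib)

lemma adj_dvd_mult: "adj_dvd z a b \<Longrightarrow> c \<in> adj z \<Longrightarrow> adj_dvd z a (b * c)"
  by (auto simp: adj_dvd_def) (metis adj_mult mult.assoc)

lemma adj_dvd_trans: "adj_dvd z a b \<Longrightarrow> adj_dvd z b c \<Longrightarrow> adj_dvd z a c"
  by (auto simp: adj_dvd_def) (metis adj_mult mult.assoc)

lemma adj_dvd_mult_mono: "adj_dvd z a b \<Longrightarrow> adj_dvd z c d \<Longrightarrow> adj_dvd z (a * c) (b * d)"
  by (auto simp: adj_dvd_def intro!: bexI[of _ "_ * _"] adj_mult)

lemma adj_dvd_power: "adj_dvd z a b \<Longrightarrow> adj_dvd z (a ^ n) (b ^ n)"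
  by (induction n) (auto intro: adj_dvd_mult_mono)

lemma adj_dvd_prod:
  "(\<And>i. i \<in> A \<Longrightarrow> adj_dvd z (f i) (g i)) \<Longrightarrow> adj_dvd z (prod f A) (prod g A)"
  by (induction A rule: infinite_finite_induct) (auto intro: adj_dvd_mult_mono)

lemma adj_dvd_mult_cancel: "c \<noteq> 0 \<Longrightarrow> adj_dvd z (c * a) (c * b) \<Longrightarrow> adj_dvd z a b"
  by (auto simp: adj_dvd_def mult.assoc)

lemma adj_dvd_power_diff:
  assumes "a \<in> adj z" "b \<in> adj z"
  shows "adj_dvd z (a - b) (a ^ n - b ^ n)"
  unfolding power_diff_sumr2 adj_dvd_def
  using assms by (intro bexI[of _ "\<Sum>i<n. b ^ (n - Suc i) * a ^ i"] refl adj_sum adj_mult adj_power) auto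

lemma adj_dvd_ev_diff:
  assumes "a \<in> adj z" "b \<in> adj z"
  shows "adj_dvd z (a - b) (ev f a - ev f b)"
proof (induction f)
  case 0
  then show ?case by simp
next
  case (pCons c f)
  have b: "ev f b \<in> adj z"
    unfolding ev_altdef using assms by (intro adj_sum adj_mult adj_power) auto
  \<comment> \<open>Product rule: this sum equals \<open>a * ev f a - b * ev f b\<close>.\<close>
  have "adj_dvd z (a - b) ((ev f a - ev f b) * a + (a - b) * ev f b)"
    using pCons assms b by (intro adj_dvd_add adj_dvd_mult) auto
  then show ?case by (simp add: algebra_simps)
qed

lemma adj_dvd_coprime:
  assumes "coprime a b" "adj_dvd z (of_nat a) r" "adj_dvd z (of_nat b) r"
  shows "adj_dvd z (of_nat (a * b)) r"
proof -
  obtain s t where st: "s * int a + t * int b = 1"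
    using assms(1) bezout_int[of "int a" "int b"] by (auto simp: coprime_iff_gcd_eq_1 gcd_int_int_eq)
  obtain c d where c: "c \<in> adj z" "r = of_nat a * c" and d: "d \<in> adj z" "r = of_nat b * d"
    using assms unfolding adj_dvd_def by blast
  have "r = of_int (s * int a + t * int b) * r" by (simp add: st)
  also have "\<dots> = of_int s * of_nat a * r + of_int t * of_nat b * r" by (simp add: distrib_right)
  also have "of_int s * of_nat a * r = of_int s * of_nat a * (of_nat b * d)" using d by simp
  also have "of_int t * of_nat b * r = of_int t * of_nat b * (of_nat a * c)" using c by simp
  finally have "r = of_nat (a * b) * (of_int s * d + of_int t * c)" by (simp add: algebra_simps)
  moreover have "of_int s * d + of_int t * c \<in> adj z"
    using c d by (intro adj_add adj_mult) auto
  ultimately show ?thesis unfolding adj_dvd_def by blast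
qed

lemma adj_dvd_prime_powers:
  assumes "n > 0" and "\<And>p a. prime p \<Longrightarrow> p ^ a dvd n \<Longrightarrow> a > 0 \<Longrightarrow> adj_dvd z (of_nat (p ^ a)) r"
    and r: "r \<in> adj z"
  shows "adj_dvd z (of_nat n) r"
  using assms(1,2)
proof (induction n rule: less_induct)
  case (less n)
  show ?case
  proof (cases "n = 1")
    case True
    then show ?thesis using r by (auto simp: adj_dvd_def)
  next
    case False
    then obtain p where p: "prime p" "p dvd n" using prime_factor_nat by blast
    define a where "a = multiplicity p n"
    have a: "a > 0" using p less.prems(1) by (simp add: a_def prime_multiplicity_gt_zero_iff)
    obtain m where m: "n = p ^ a * m" "\<not> p dvd m"
      using multiplicity_decompose'[of n p] p less.prems(1) not_prime_unit
      by (metis a_def bot_nat_0.not_eq_extremum)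
    have "p ^ a > 1" using a p prime_gt_1_nat one_less_power by blast
    moreover have "m > 0" using m less.prems(1) by (cases m) auto
    ultimately have "m < n" using n_less_m_mult_n[of m "p ^ a"] unfolding m(1) by simp
    have "m dvd n" "p ^ a dvd n" unfolding m(1) by simp_all
    have "adj_dvd z (of_nat m) r"
      by (rule less.IH[OF \<open>m < n\<close> \<open>m > 0\<close>], rule less.prems(2))
        (blast intro: dvd_trans[OF _ \<open>m dvd n\<close>])+
    moreover have "adj_dvd z (of_nat (p ^ a)) r"
      using p(1) \<open>p ^ a dvd n\<close> a by (rule less.prems(2))
    moreover have "coprime (p ^ a) m" using p m by (simp add: prime_imp_coprime)
    ultimately show ?thesis unfolding m(1) by (intro adj_dvd_coprime)
  qed
qed

text \<open>Modulo \<open>\<pi>\<close>, complex conjugation is the \<open>p ^ j\<close>-th power map; in particular the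
  ring is reduced modulo \<open>\<pi>\<close>, which turns \<open>\<pi> dvd x * cnj x\<close> into \<open>\<pi> dvd x\<close>.\<close>

context
  fixes z \<pi> :: complex and k p j :: nat
  assumes z: "z ^ k = 1" "k > 0" and p: "prime p"
    and pi_p: "adj_dvd z \<pi> (of_nat p)" and pi_z: "adj_dvd z \<pi> (z ^ (p ^ j + 1) - 1)"
begin

lemma frobenius_cnj_mod:
  assumes "x \<in> adj z"
  shows "adj_dvd z \<pi> (x ^ (p ^ j) - cnj x)"
proof -
  obtain f where x: "x = ev f z" using assms by (auto simp: adj_def)
  obtain h where h: "f ^ (p ^ j) - pcompose f (monom 1 (p ^ j)) = of_nat p * h"
    using frobenius_poly_iterated[OF p, of f j] by auto
  have "x ^ (p ^ j) - ev f (z ^ (p ^ j)) = of_nat p * ev h z"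
    using arg_cong[OF h, of "\<lambda>f. ev f z"] by (simp add: x)
  then have 1: "adj_dvd z \<pi> (x ^ (p ^ j) - ev f (z ^ (p ^ j)))"
    using pi_p by (auto intro: adj_dvd_mult)
  have cz: "cnj z \<in> adj z" by (rule adj_cnj[OF z]) simp
  \<comment> \<open>As \<open>cnj z\<close> is the inverse of \<open>z\<close>, this factor turns
    \<open>z ^ (p ^ j + 1) = 1\<close> into \<open>z ^ (p ^ j) = cnj z\<close> modulo
    \<open>\<pi>\<close>.\<close>
  have "adj_dvd z \<pi> ((z ^ (p ^ j + 1) - 1) * cnj z)"
    using pi_z cz by (rule adj_dvd_mult)
  also have "(z ^ (p ^ j + 1) - 1) * cnj z = z ^ (p ^ j) * (cnj z * z) - cnj z"
    by (simp add: algebra_simps)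
  finally have "adj_dvd z \<pi> (z ^ (p ^ j) - cnj z)"
    by (simp only: cnj_unity(1)[OF z] mult_1_right)
  then have "adj_dvd z \<pi> (ev f (z ^ (p ^ j)) - ev f (cnj z))"
    by (rule adj_dvd_trans) (intro adj_dvd_ev_diff adj_power[OF adj_self] cz)
  from adj_dvd_add[OF 1 this] show ?thesis by (simp add: x cnj_ev)
qed

text \<open>With \<open>q = p ^ j\<close>, conjugating twice gives \<open>x ^ (q * q) = x\<close>
  modulo \<open>\<pi>\<close>, while \<open>x ^ (q + 1)\<close> is congruent to
  \<open>x * cnj x\<close>, hence to 0. As \<open>q + 1 \<le> q * q\<close> for
  \<open>q \<ge> 2\<close>, \<open>x\<close> is 0 modulo \<open>\<pi>\<close> too.\<close>

lemma pi_dvd_if_dvd_norm: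
  assumes j: "j > 0" and x: "x \<in> adj z" and dvd: "adj_dvd z \<pi> (x * cnj x)"
  shows "adj_dvd z \<pi> x"
proof -
  define q where "q = p ^ j"
  have q: "q \<ge> 2" using j p prime_ge_2_nat[OF p] self_le_power[of p j] by (auto simp: q_def)
  have cx: "cnj x \<in> adj z" by (rule adj_cnj[OF z x])
  have mod: "adj_dvd z \<pi> (x ^ q - cnj x)" if "x \<in> adj z" for x
    using frobenius_cnj_mod[OF that] by (simp add: q_def)
  have "adj_dvd z \<pi> ((x ^ q) ^ q - cnj x ^ q)"
    by (rule adj_dvd_trans[OF mod[OF x]]) (use x cx in \<open>auto intro: adj_dvd_power_diff adj_power\<close>)
  from adj_dvd_add[OF this mod[OF cx]] have 1: "adj_dvd z \<pi> (x ^ (q * q) - x)"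
    by (simp add: power_mult)
  have "adj_dvd z \<pi> ((x ^ q - cnj x) * x + x * cnj x)"
    by (rule adj_dvd_add[OF adj_dvd_mult[OF mod[OF x] x] dvd])
  then have "adj_dvd z \<pi> (x ^ (q + 1))" by (simp add: algebra_simps)
  then have "adj_dvd z \<pi> (x ^ (q + 1) * x ^ (q * q - (q + 1)))"
    using x by (intro adj_dvd_mult adj_power)
  moreover have "q + 1 \<le> q * q"
  proof -
    have "q + 1 \<le> 2 * q" using q by simp
    also have "\<dots> \<le> q * q" using q by (intro mult_right_mono) auto
    finally show ?thesis .
  qed
  then have "x ^ (q + 1) * x ^ (q * q - (q + 1)) = x ^ (q * q)"
    by (metis le_add_diff_inverse power_add)
  ultimately have "adj_dvd z \<pi> (x ^ (q * q))" by simp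
  from adj_dvd_diff[OF this 1] show ?thesis by simp
qed

text \<open>Strong induction lowering \<open>b\<close> by 2: with \<open>x = \<pi> * x'\<close>, the
  product \<open>x * cnj x\<close> contains \<open>\<pi> * cnj \<pi>\<close>, which \<open>u\<close>
  turns into \<open>\<pi> ^ 2\<close>, so \<open>\<pi> ^ (b - 2)\<close> divides
  \<open>x' * cnj x'\<close>. The case \<open>b = 1\<close> is separate, as \<open>b - 2\<close>
  would truncate.\<close>

lemma pi_power_dvd_square:
  assumes j: "j > 0" and pi: "\<pi> \<noteq> 0" "\<pi> = u * cnj \<pi>" "u \<in> adj z" "\<pi> \<in> adj z"
    and x: "x \<in> adj z" and dvd: "adj_dvd z (\<pi> ^ b) (x * cnj x)"
  shows "adj_dvd z (\<pi> ^ b) (x ^ 2)"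
  using x dvd
proof (induction b arbitrary: x rule: less_induct)
  case (less b)
  show ?case
  proof (cases "b = 0")
    case True
    then show ?thesis using less.prems by (auto simp: adj_dvd_def intro: adj_power)
  next
    case False
    have "adj_dvd z \<pi> (\<pi> ^ b)"
      using adj_dvd_mult[OF adj_dvd_refl adj_power[OF pi(4), of "b - 1"], of \<pi>] False
      by (simp only: power_eq_if[of \<pi> b] if_False)
    then have "adj_dvd z \<pi> x"
      by (rule pi_dvd_if_dvd_norm[OF j less.prems(1) adj_dvd_trans[OF _ less.prems(2)]])
    then obtain x' where x': "x' \<in> adj z" "x = \<pi> * x'" by (auto simp: adj_dvd_def)
    have sq: "x ^ 2 = \<pi> ^ 2 * x' ^ 2" by (simp add: x' power_mult_distrib)
    show ?thesis
    proof (cases "b = 1")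
      case True
      have "x ^ 2 = \<pi> * (\<pi> * x' ^ 2)" unfolding sq by (simp add: power2_eq_square)
      moreover have "\<pi> * x' ^ 2 \<in> adj z" using x'(1) pi(4) by (intro adj_mult adj_power)
      ultimately show ?thesis unfolding adj_dvd_def using True by auto
    next
      case False
      with \<open>b \<noteq> 0\<close> have "2 + (b - 2) = b" by simp
      then have b: "\<pi> ^ b = \<pi> ^ 2 * \<pi> ^ (b - 2)" by (metis power_add)
      have "\<pi> ^ 2 * (x' * cnj x') = u * cnj \<pi> * \<pi> * (x' * cnj x')"
        unfolding power2_eq_square using pi(2) by simp
      also have "\<dots> = x * cnj x * u" by (simp add: x' algebra_simps)
      finally have "adj_dvd z (\<pi> ^ b) (\<pi> ^ 2 * (x' * cnj x'))"
        using adj_dvd_mult[OF less.prems(2) pi(3)] by simp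
      then have "adj_dvd z (\<pi> ^ 2 * \<pi> ^ (b - 2)) (\<pi> ^ 2 * (x' * cnj x'))"
        by (simp only: b)
      then have "adj_dvd z (\<pi> ^ (b - 2)) (x' * cnj x')"
        by (rule adj_dvd_mult_cancel[rotated]) (simp add: pi(1))
      then have "adj_dvd z (\<pi> ^ (b - 2)) (x' ^ 2)"
        using \<open>b \<noteq> 0\<close> x' by (intro less.IH) auto
      then have "adj_dvd z (\<pi> ^ 2 * \<pi> ^ (b - 2)) (\<pi> ^ 2 * x' ^ 2)"
        by (intro adj_dvd_mult_mono) auto
      then show ?thesis by (simp only: sq b)
    qed
  qed
qed

lemma prime_power_dvd_square:
  assumes j: "j > 0" and pi: "\<pi> \<noteq> 0" "\<pi> = u * cnj \<pi>" "u \<in> adj z" "\<pi> \<in> adj z"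
    and assoc: "adj_dvd z (\<pi> ^ M) (of_nat p)" "adj_dvd z (of_nat p) (\<pi> ^ M)"
    and x: "x \<in> adj z" and dvd: "adj_dvd z (of_nat (p ^ a)) (x * cnj x)"
  shows "adj_dvd z (of_nat (p ^ a)) (x ^ 2)"
proof -
  have 1: "adj_dvd z (\<pi> ^ (M * a)) (of_nat (p ^ a))"
    and 2: "adj_dvd z (of_nat (p ^ a)) (\<pi> ^ (M * a))"
    using adj_dvd_power[OF assoc(1), of a] adj_dvd_power[OF assoc(2), of a]
    by (simp_all add: power_mult)
  have "adj_dvd z (\<pi> ^ (M * a)) (x ^ 2)"
    using adj_dvd_trans[OF 1 dvd] by (rule pi_power_dvd_square[OF j pi x])
  with 2 show ?thesis by (rule adj_dvd_trans)
qed

end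

subsection \<open>The prime above p in a cyclotomic ring\<close>

text \<open>The product \<open>f\<close> of the \<open>x - w\<close> and the geometric sum
  \<open>g\<close>, which is \<open>x ^ (p * r) - 1\<close> divided by \<open>x ^ r - 1\<close>, are
  monic of degree \<open>p * r - r\<close> and vanish on the same \<open>p * r - r\<close> points.
  They are therefore equal, and are evaluated at 1.\<close>

lemma prod_one_minus_roots_of_unity:
  fixes p r :: nat
  assumes p: "p > 0" and r: "r > 0"
  shows "(\<Prod>w\<in>{w. w ^ (p * r) = 1} - {w. w ^ r = 1}. 1 - w) = (of_nat p :: complex)"
proof -
  let ?A = "{w::complex. w ^ (p * r) = 1}" and ?B = "{w::complex. w ^ r = 1}"
  define S where "S = ?A - ?B"
  have fin: "finite ?A" "finite ?B" using p r by (auto intro!: finite_unity)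
  have "?B \<subseteq> ?A" by (auto simp: mult.commute[of p] power_mult)
  then have card: "card S = p * r - r"
    unfolding S_def using fin p r by (simp add: card_Diff_subset card_roots_unity_eq)
  define f where "f = (\<Prod>w\<in>S. [:- w, 1:])"
  define g where "g = (\<Sum>i<p. monom (1::complex) (i * r))"
  have deg_f: "degree f = card S" and lead_f: "lead_coeff f = 1"
    unfolding f_def by (subst degree_prod_eq_sum_degree; simp) (simp add: lead_coeff_prod)
  have deg_g: "degree g \<le> p * r - r"
    unfolding g_def
  proof (intro degree_sum_le)
    fix i assume "i \<in> {..<p}"
    then have "i * r \<le> (p - 1) * r" by (intro mult_right_mono) auto
    then show "degree (monom (1::complex) (i * r)) \<le> p * r - r"
      by (simp add: degree_monom_eq diff_mult_distrib)
  qed auto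
  have "coeff g (p * r - r) = (\<Sum>i<p. if i = p - 1 then 1 else 0)"
    unfolding g_def coeff_sum coeff_monom
  proof (intro sum.cong refl)
    fix i assume "i \<in> {..<p}"
    have "p * r - r = (p - 1) * r" by (simp add: diff_mult_distrib)
    then have "(i * r = p * r - r) = (i = p - 1)" using r by simp
    then show "(if i * r = p * r - r then 1 else 0) = (if i = p - 1 then 1 else (0::complex))"
      by simp
  qed
  then have lead_g: "coeff g (p * r - r) = 1" using p by simp
  have "f = g"
  proof (rule poly_eqI_degree_lead_coeff[of _ "p * r - r" _ S])
    show "coeff f (p * r - r) = coeff g (p * r - r)"
      using lead_f lead_g by (simp add: deg_f card)
    fix w assume w: "w \<in> S"
    have "poly f w = 0" unfolding f_def poly_prod using w fin by (auto simp: S_def intro!: prod_zero)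
    moreover have "poly g w = (\<Sum>i<p. (w ^ r) ^ i)"
      by (simp add: g_def poly_sum poly_monom mult.commute flip: power_mult)
    moreover have "(w ^ r) ^ p = 1" using w by (simp add: S_def mult.commute flip: power_mult)
    then have "(\<Sum>i<p. (w ^ r) ^ i) = 0" using w by (simp add: sum_powers_root_of_unity S_def)
    ultimately show "poly f w = poly g w" by simp
  qed (use deg_f deg_g card in auto)
  then have "poly f 1 = poly g 1" by simp
  then show ?thesis by (simp add: f_def g_def poly_prod poly_sum poly_monom S_def)
qed

lemma adj_dvd_one_minus_power:
  assumes "w \<in> adj z"
  shows "adj_dvd z (1 - w) (1 - w ^ i)"
  using adj_dvd_power_diff[of 1 z w i] assms by simp

lemma zeta_cis: "zeta m = cis (2 * pi / real m)"
  by (simp add: zeta_def cis_conv_exp mult_ac)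

lemma zeta_power_self: "m > 0 \<Longrightarrow> zeta m ^ m = 1"
  by (simp add: zeta_cis DeMoivre)

lemma zeta_mult_power: "m > 0 \<Longrightarrow> zeta (m * r) ^ m = zeta r"
  by (simp add: zeta_cis DeMoivre)

lemma root_of_unity_zeta_power:
  assumes "w ^ m = 1" "m > 0"
  obtains i where "w = zeta m ^ i"
proof -
  have "w \<in> (\<lambda>i. cis (2 * pi * real i / real m)) ` {..<m}"
    using bij_betw_roots_unity[OF assms(2)] assms(1) unfolding bij_betw_def by auto
  then show ?thesis using that by (auto simp: zeta_cis DeMoivre mult_ac)
qed

text \<open>The product formula writes \<open>p\<close> as the product of \<open>1 - w\<close> over
  the roots \<open>w\<close> of exact order \<open>p ^ e\<close>. Each such \<open>w\<close> and
  \<open>zeta (p ^ e)\<close> are powers of one another, so all factors are associated, and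
  \<open>M\<close> is their number.\<close>

lemma one_minus_zeta_associated_prime:
  assumes p: "prime p" and e: "e > 0" and z: "zeta (p ^ e) \<in> adj z"
  obtains M where "adj_dvd z ((1 - zeta (p ^ e)) ^ M) (of_nat p)"
    and "adj_dvd z (of_nat p) ((1 - zeta (p ^ e)) ^ M)"
proof -
  let ?w = "zeta (p ^ e)" and ?r = "p ^ (e - 1)"
  define S where "S = {w::complex. w ^ (p * ?r) = 1} - {w. w ^ ?r = 1}"
  have p0: "p > 0" using p prime_gt_0_nat by simp
  have pe: "p * ?r = p ^ e" using e by (metis power_eq_if not_gr_zero)
  have prod: "(\<Prod>w\<in>S. 1 - w) = of_nat p"
    unfolding S_def using p0 by (intro prod_one_minus_roots_of_unity) auto
  have assoc: "adj_dvd z (1 - ?w) (1 - w) \<and> adj_dvd z (1 - w) (1 - ?w)" if w: "w \<in> S" for w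
  proof -
    have "w ^ (p ^ e) = 1" using w by (simp only: S_def pe Diff_iff mem_Collect_eq)
    then obtain i where i: "w = ?w ^ i" by (rule root_of_unity_zeta_power) (use p0 in auto)
    have "\<not> p dvd i"
    proof
      assume "p dvd i"
      then obtain i' where "i = p * i'" by auto
      then have "w ^ ?r = (?w ^ (p ^ e)) ^ i'"
        by (simp add: i pe[symmetric] mult_ac flip: power_mult)
      also have "\<dots> = 1" using p0 by (simp add: zeta_power_self)
      finally show False using w by (simp add: S_def)
    qed
    then have "coprime i (p ^ e)" using p prime_imp_coprime[of p i] by (simp add: coprime_commute)
    from cong_solve_coprime_nat[OF this] obtain i' where "[i * i' = 1] (mod p ^ e)"
      by auto
    then have eq: "i * i' mod p ^ e = 1 mod p ^ e" by (simp add: cong_def)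
    have mod: "?w ^ t = ?w ^ (t mod p ^ e)" for t
    proof -
      have "?w ^ t = ?w ^ (p ^ e * (t div p ^ e) + t mod p ^ e)" by simp
      also have "\<dots> = ?w ^ (t mod p ^ e)"
        unfolding power_add power_mult using p0 by (simp add: zeta_power_self)
      finally show ?thesis .
    qed
    have "w ^ i' = ?w"
      using mod[of "i * i'"] mod[of 1] eq by (simp add: i flip: power_mult)
    moreover have "w \<in> adj z" using z by (simp add: i adj_power)
    ultimately show ?thesis
      using adj_dvd_one_minus_power[of w z i'] adj_dvd_one_minus_power[OF z, of i] by (simp add: i)
  qed
  have "adj_dvd z (\<Prod>w\<in>S. 1 - ?w) (\<Prod>w\<in>S. 1 - w)" "adj_dvd z (\<Prod>w\<in>S. 1 - w) (\<Prod>w\<in>S. 1 - ?w)"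
    using assoc by (blast intro: adj_dvd_prod)+
  then show ?thesis using that[of "card S"] by (simp add: prod)
qed

section \<open>From the norm equation to divisibility of the square\<close>

lemma dvd_square_if_dvd_norm:
  assumes k: "k > 0" and p: "prime p"
    and sc: "[int p ^ j = - 1] (mod int (k div prime_part p k))"
    and x: "x \<in> adj (zeta k)" and dvd: "adj_dvd (zeta k) (of_nat (p ^ a)) (x * cnj x)"
  shows "adj_dvd (zeta k) (of_nat (p ^ a)) (x ^ 2)"
proof -
  define e where "e = multiplicity p k"
  define m where "m = k div p ^ e"
  have km: "k = m * p ^ e"
    unfolding m_def e_def by (simp add: multiplicity_dvd)
  have m0: "m > 0" and p0: "p > 0" using k km p prime_gt_0_nat by (auto intro: Nat.gr0I)
  have cop: "\<not> p dvd m"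
    using multiplicity_decompose[of k p] k p not_prime_unit[of p] unfolding m_def e_def by blast
  \<comment> \<open>The descent needs a positive exponent. If the given one is 0, then
    \<open>m\<close> divides 2 and exponent 1 serves, since \<open>p\<close> is odd when
    \<open>m = 2\<close>.\<close>
  obtain j where j: "j > 0" "m dvd p ^ j + 1"
  proof (cases "j = 0")
    case False
    have "int m dvd int (p ^ j + 1)"
      using sc by (simp add: cong_iff_dvd_diff prime_part_def m_def e_def add.commute)
    then have "m dvd p ^ j + 1" by (simp only: int_dvd_int_iff)
    then show ?thesis using False that[of j] by simp
  next
    case True
    then have "int m dvd 2" using sc
      by (simp add: cong_iff_dvd_diff prime_part_def m_def e_def)
    then have "m dvd 2" by (metis int_dvd_int_iff of_nat_numeral)
    then have "m = 1 \<or> m = 2" by (metis prime_nat_iff two_is_prime_nat)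
    then have "m dvd p + 1"
    proof
      assume "m = 2"
      have "odd p"
      proof
        assume "even p"
        then have "2 = p" using p two_is_prime_nat by (intro primes_dvd_imp_eq)
        with cop \<open>m = 2\<close> show False by simp
      qed
      with \<open>m = 2\<close> show ?thesis by simp
    qed simp
    then show ?thesis using that[of 1] by simp
  qed
  then obtain t where t: "p ^ j + 1 = m * t" by auto
  have zk: "zeta k ^ k = 1" by (rule zeta_power_self[OF k])
  show ?thesis
  proof (cases "e = 0")
    case True
    \<comment> \<open>Here \<open>m = k\<close>, so the congruence for \<open>zeta k\<close> is an
      equality and \<open>p\<close> itself serves as \<open>\<pi>\<close>.\<close>
    then have "zeta k ^ (p ^ j + 1) = 1" unfolding t using km zk by (simp add: power_mult)
    then have 1: "adj_dvd (zeta k) (of_nat p) (zeta k ^ (p ^ j + 1) - 1)" by simp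
    show ?thesis
      by (rule prime_power_dvd_square[OF zk k p adj_dvd_refl 1 j(1), where u = 1 and M = 1])
        (use p0 x dvd in auto)
  next
    case False
    define w where "w = zeta (p ^ e)"
    have w: "w = zeta k ^ m" unfolding km w_def using m0 by (simp add: zeta_mult_power)
    have w_adj: "w \<in> adj (zeta k)" by (simp add: w adj_power)
    have wpe: "w ^ (p ^ e) = 1" using p0 by (simp add: w_def zeta_power_self)
    obtain M where M: "adj_dvd (zeta k) ((1 - w) ^ M) (of_nat p)" "adj_dvd (zeta k) (of_nat p) ((1 - w) ^ M)"
      using one_minus_zeta_associated_prime[OF p, of e "zeta k"] False w_adj unfolding w_def by blast
    \<comment> \<open>For \<open>M = 0\<close> the prime \<open>p\<close> would be invertible in the
      ring and so divide 1. Positivity of \<open>M\<close> yields that \<open>1 - w\<close> is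
      nonzero and divides \<open>p\<close>.\<close>
    have M0: "M \<noteq> 0"
    proof
      assume "M = 0"
      then have "adj_dvd (zeta k) (of_nat p) 1" using M by simp
      then obtain c where c: "c \<in> adj (zeta k)" "of_nat p * c = 1" by (auto simp: adj_dvd_def)
      obtain f where "c = ev f (zeta k)" using c by (auto simp: adj_def)
      moreover obtain \<phi> \<psi> where "unity_conjugates k (zeta k) \<phi> \<psi>"
        by (rule unity_conjugates_exist[OF k zk])
      ultimately have "int p dvd 1"
        using unity_conjugates.rational_value_is_integer[OF _ p, of k "zeta k" \<phi> \<psi> f 1] c by simp
      then show False using p by (simp add: int_dvd_int_iff[of p 1, simplified])
    qed
    then have "1 - w \<noteq> 0" using M(1) p0 by (auto simp: adj_dvd_def zero_power)
    have pi_adj: "1 - w \<in> adj (zeta k)" using w_adj by (intro adj_diff) auto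
    have "adj_dvd (zeta k) (1 - w) ((1 - w) * (1 - w) ^ (M - 1))"
      using pi_adj by (intro adj_dvd_mult adj_power) auto
    then have "adj_dvd (zeta k) (1 - w) ((1 - w) ^ M)" using M0 by (simp flip: power_Suc)
    then have pi_p: "adj_dvd (zeta k) (1 - w) (of_nat p)" using M(1) by (rule adj_dvd_trans)
    have "adj_dvd (zeta k) (1 - w) ((1 - w ^ t) * (- 1))"
      using w_adj by (intro adj_dvd_mult adj_dvd_one_minus_power adj_uminus adj_consts)
    then have pi_z: "adj_dvd (zeta k) (1 - w) (zeta k ^ (p ^ j + 1) - 1)"
      unfolding t by (simp add: w power_mult)
    have "cnj w * w = 1" using wpe p0 by (intro cnj_unity(1)[of _ "p ^ e"]) auto
    \<comment> \<open>The unit relating \<open>1 - w\<close> to its conjugate is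
      \<open>- w\<close>.\<close>
    then have conj: "1 - w = - w * cnj (1 - w)" by (simp add: algebra_simps)
    show ?thesis
      by (rule prime_power_dvd_square[OF zk k p pi_p pi_z j(1) \<open>1 - w \<noteq> 0\<close> conj _ pi_adj M x dvd])
        (use w_adj in \<open>auto intro: adj_uminus\<close>)
  qed
qed

lemma self_conjugate_dvd_square:
  assumes k: "k > 0" and n: "n > 0" and sc: "self_conjugate_mod n k"
    and x: "x \<in> adj (zeta k)" and norm: "x * cnj x = of_nat n"
  shows "adj_dvd (zeta k) (of_nat n) (x ^ 2)"
proof (rule adj_dvd_prime_powers[OF n])
  fix p a :: nat
  assume p: "prime p" "p ^ a dvd n" "a > 0"
  then have "p dvd n" by (metis dvd_power dvd_trans)
  then obtain j where "[int p ^ j = - 1] (mod int (k div prime_part p k))"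
    using sc p by (auto simp: self_conjugate_mod_def)
  moreover have "adj_dvd (zeta k) (of_nat (p ^ a)) (x * cnj x)"
    unfolding norm using p(2) by (auto simp: adj_dvd_def elim!: dvdE)
  ultimately show "adj_dvd (zeta k) (of_nat (p ^ a)) (x ^ 2)"
    using dvd_square_if_dvd_norm k p x by blast
qed (use x in \<open>auto intro: adj_power\<close>)

text \<open>The conditions on \<open>N\<close> make the power \<open>N + 1\<close> fix
  \<open>zeta k\<close> while still commuting with evaluation, so \<open>u = ev g (zeta k)\<close>
  satisfies \<open>u ^ (N + 1) = u\<close>.\<close>

lemma square_eq_root_of_unity_mult:
  assumes k: "k > 0" and n: "n > 0" and sc: "self_conjugate_mod n k"
    and x: "x \<in> adj (zeta k)" and norm: "x * cnj x = of_nat n"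
    and N: "coprime (N + 1) (2 * k)" "k dvd N"
  obtains u where "x ^ 2 = of_nat n * u" "u ^ N = 1"
proof -
  have zk: "zeta k ^ k = 1" by (rule zeta_power_self[OF k])
  obtain \<phi> \<psi> where "unity_conjugates k (zeta k) \<phi> \<psi>"
    by (rule unity_conjugates_exist[OF k zk])
  then interpret unity_conjugates k "zeta k" \<phi> \<psi> .
  obtain f where f: "x = ev f (zeta k)" using x by (auto simp: adj_def)
  obtain g where g: "x ^ 2 = of_nat n * ev g (zeta k)"
    using self_conjugate_dvd_square[OF k n sc x norm] by (auto simp: adj_dvd_def adj_def)
  \<comment> \<open>Conjugation is the \<open>(k - 1)\<close>-th power on \<open>k\<close>-th roots
    of unity, so the norm equation and the equation for the square are polynomial relations that
    transfer to \<open>w\<close>.\<close>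
  have "cmod (ev g w) = 1" if w: "ev \<phi> w = 0" for w
  proof -
    have "ev f (zeta k) * ev f (zeta k ^ (k - 1)) = of_nat n"
      using norm unfolding f cnj_ev cnj_unity(2)[OF zk k] .
    then have "ev (f * pcompose f (monom 1 (k - 1)) - of_nat n) (zeta k) = 0" by simp
    from transfer[OF this w] have "ev f w * ev f (w ^ (k - 1)) = of_nat n" by simp
    then have "ev f w * cnj (ev f w) = of_nat n"
      unfolding cnj_ev cnj_unity(2)[OF conj_root_unity[OF w] k] .
    then have "complex_of_real ((cmod (ev f w))\<^sup>2) = of_nat n"
      by (simp only: complex_norm_square)
    then have 1: "(cmod (ev f w))\<^sup>2 = real n" by (metis of_real_eq_iff of_real_of_nat_eq)
    have "ev (f ^ 2 - of_nat n * g) (zeta k) = 0" using g by (simp add: f)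
    from transfer[OF this w] have "ev f w ^ 2 = of_nat n * ev g w" by simp
    then have "cmod (ev f w) ^ 2 = real n * cmod (ev g w)" by (metis norm_mult norm_of_nat norm_power)
    with 1 n show ?thesis by simp
  qed
  then have "ev g (zeta k) ^ (N + 1) = ev g (zeta k ^ (N + 1))"
    using conj_unimodular_power[of "N + 1" g] N by simp
  also have "zeta k ^ (N + 1) = zeta k"
    using N(2) zk by (auto elim!: dvdE simp: power_mult)
  finally have "ev g (zeta k) ^ N * ev g (zeta k) = 1 * ev g (zeta k)" by (simp add: mult.commute)
  moreover have "ev g (zeta k) \<noteq> 0" using g norm n by auto
  ultimately have "ev g (zeta k) ^ N = 1" by simp
  with g that show ?thesis by blast
qed

section \<open>Entries of the scaled image\<close>

lemma zeta_group_subset_adj: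
  assumes "k > 0" "w \<in> zeta_group k"
  shows "w \<in> adj (zeta k)"
proof -
  have "w ^ k = 1" using assms by (simp add: zeta_group_eq)
  then obtain i where "w = zeta k ^ i" by (rule root_of_unity_zeta_power) (rule assms)
  then show ?thesis by (simp add: adj_power)
qed

theorem theorem3p5:
  fixes n k :: nat and H :: "complex mat" and x y :: "complex vec"
  assumes "n > 0" and "k > 0"
    and "H \<in> BH n k"
    and "bent n k H x"
    and "y = scaled_image n H x"
    and "self_conjugate_mod n k"
  shows "\<forall>i<n. (even k \<longrightarrow> y $ i \<in> zeta_group (2 * k)) \<and>
               (odd k \<longrightarrow> y $ i \<in> zeta_group (4 * k))"
proof (intro allI impI)
  fix i assume i: "i < n"
  define X where "X = (H *\<^sub>v x) $ i"
  have H: "H \<in> carrier_mat n n" "\<And>i j. i < n \<Longrightarrow> j < n \<Longrightarrow> H $$ (i, j) \<in> zeta_group k"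
    using assms by (auto simp: BH_def)
  have x: "x \<in> carrier_vec n" "\<And>i. i < n \<Longrightarrow> x $ i \<in> zeta_group k"
    using assms by (auto simp: bent_def zeta_vecs_def)
  have y: "y $ i = X / complex_of_real (sqrt (real n))"
    using assms(5) H x i by (simp add: scaled_image_def X_def)
  have "X = (\<Sum>j\<in>{0..<n}. H $$ (i, j) * x $ j)"
    using H(1) x(1) i by (auto simp: X_def scalar_prod_def)
  also have "\<dots> \<in> adj (zeta k)"
    using H(2) x(2) i assms(2) by (intro adj_sum adj_mult zeta_group_subset_adj) auto
  finally have X: "X \<in> adj (zeta k)" .
  have sqrt: "complex_of_real (sqrt (real n)) ^ 2 = of_nat n"
    by (metis of_nat_0_le_iff of_real_of_nat_eq of_real_power real_sqrt_pow2)
  have "cmod (y $ i) = 1" using assms(4,5) i by (simp add: bent_def)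
  then have "cmod X = sqrt (real n)" using assms(1) by (simp add: y norm_divide field_simps)
  then have norm: "X * cnj X = of_nat n" by (metis complex_norm_square sqrt of_real_power)
  have *: "(y $ i) ^ (2 * N) = 1" if N: "coprime (N + 1) (2 * k)" "k dvd N" for N
  proof -
    obtain u where "X ^ 2 = of_nat n * u" "u ^ N = 1"
      by (rule square_eq_root_of_unity_mult[OF assms(2,1,6) X norm N])
    moreover from this have "(y $ i) ^ 2 = u"
      using assms(1) by (simp add: y power_divide sqrt)
    ultimately show ?thesis by (simp add: power_mult)
  qed
  \<comment> \<open>The choices are \<open>N = k\<close> for even \<open>k\<close> and
    \<open>N = 2 * k\<close> for odd \<open>k\<close>. The square of \<open>y $ i\<close> has order
    dividing \<open>N\<close>, which doubles to \<open>2 * k\<close> and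
    \<open>4 * k\<close>.\<close>
  have 1: "coprime (k + 1) (2 * k)" if "even k"
    using that by (simp add: coprime_Suc_left_nat coprime_commute)
  have 2: "coprime (2 * k + 1) (2 * k)" by (metis Suc_eq_plus1 coprime_Suc_left_nat)
  show "(even k \<longrightarrow> y $ i \<in> zeta_group (2 * k)) \<and> (odd k \<longrightarrow> y $ i \<in> zeta_group (4 * k))"
    using *[OF 1] *[OF 2] assms(2) by (simp add: zeta_group_eq)
qed

end
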